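(* Let $\mathbb{K}$ be an algebraically closed field of characteristic zero, let $n\ge 1$, and let $L$ be a Lie subalgebra of $W_n(\mathbb{K})$. Assume that $L$ is a $\mathbb{K}[X]$-submodule of rank one in the $\mathbb{K}[X]$-module $W_n(\mathbb{K})$. Then for every nonzero element $D\in L$ the centralizer $C_L(D)=\{E\in L : [D,E]=0\}$ of $D$ in $L$ is abelian.
   Context: $\mathbb{K}[X]:=\mathbb{K}[x_1,\ldots,x_n]$ is the polynomial algebra, and $W_n(\mathbb{K})$ is the Lie algebra over $\mathbb{K}$ of all $\mathbb{K}$-linear derivations of $\mathbb{K}[X]$ with the commutator bracket; it is a free $\mathbb{K}[X]$-module with basis $\frac{\partial}{\partial x_1},\ldots,\frac{\partial}{\partial x_n}$. The rank of a $\mathbb{K}[X]$-submodule is the maximal number of its elements that are linearly independent over $\mathbb{K}[X]$. *)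

theory Defs
  imports
    "HOL-Library.Poly_Mapping"
    "HOL-Library.Function_Algebras"
    "HOL-Library.Extended_Nat"
    "HOL-Computational_Algebra.Polynomial"
begin

text \<open>
  \<^typ>\<open>('n \<Rightarrow>\<^sub>0 nat) \<Rightarrow>\<^sub>0 'k\<close> is the commutative polynomial algebra over the field
  \<open>'k\<close> in variables indexed by the type \<open>'n\<close>: outer keys are exponent vectors of monomials,
  outer values are coefficients, and \<open>*\<close> is convolution.  For a finite index type with
  \<open>n = CARD('n)\<close> this is \<open>K[x\<^sub>1, \<dots>, x\<^sub>n]\<close>; types being nonempty, \<open>n \<ge> 1\<close> always holds.
\<close>

type_synonym ('n, 'k) mpoly = "('n \<Rightarrow>\<^sub>0 nat) \<Rightarrow>\<^sub>0 'k"

definition const :: "'k \<Rightarrow> ('n, 'k::field) mpoly" where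
  "const c = Poly_Mapping.single 0 c"

definition scale_poly :: "'k \<Rightarrow> ('n, 'k::field) mpoly \<Rightarrow> ('n, 'k) mpoly" where
  "scale_poly c p = const c * p"

text \<open>
  Addition, subtraction and zero of operators are the pointwise ones of
  \<^theory>\<open>HOL-Library.Function_Algebras\<close>.  (The pointwise product from that theory
  plays no role here.)
\<close>

type_synonym ('n, 'k) operator = "('n, 'k) mpoly \<Rightarrow> ('n, 'k) mpoly"

definition scale_op :: "('n, 'k::field) mpoly \<Rightarrow> ('n, 'k) operator \<Rightarrow> ('n, 'k) operator" where
  "scale_op f D = (\<lambda>p. f * D p)"

definition scalar_op :: "'k \<Rightarrow> ('n, 'k::field) operator \<Rightarrow> ('n, 'k) operator" where
  "scalar_op c D = (\<lambda>p. scale_poly c (D p))"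

definition derivation :: "('n, 'k::field) operator \<Rightarrow> bool" where
  "derivation D \<longleftrightarrow>
     Vector_Spaces.linear scale_poly scale_poly D \<and> (\<forall>p q. D (p * q) = D p * q + p * D q)"

definition W :: "('n, 'k::field) operator set" where
  "W = {D. derivation D}"

definition bracket :: "('n, 'k::field) operator \<Rightarrow> ('n, 'k) operator \<Rightarrow> ('n, 'k) operator" where
  "bracket D E = (\<lambda>p. D (E p) - E (D p))"

definition lie_subalgebra_W :: "('n, 'k::field) operator set \<Rightarrow> bool" where
  "lie_subalgebra_W L \<longleftrightarrow>
     L \<subseteq> W \<and> module.subspace scalar_op L \<and> (\<forall>D\<in>L. \<forall>E\<in>L. bracket D E \<in> L)"

definition submodule_W :: "('n, 'k::field) operator set \<Rightarrow> bool" where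
  "submodule_W M \<longleftrightarrow> M \<subseteq> W \<and> module.subspace scale_op M"

text \<open>
  The rank takes values in \<^typ>\<open>enat\<close>, so that it is \<open>\<infinity>\<close> rather than a junk number
  if there are arbitrarily large linearly independent finite subsets.
\<close>

definition rank :: "('n, 'k::field) operator set \<Rightarrow> enat" where
  "rank M = (SUP B \<in> {B. B \<subseteq> M \<and> finite B \<and> \<not> module.dependent scale_op B}. enat (card B))"

definition centralizer ::
  "('n, 'k::field) operator set \<Rightarrow> ('n, 'k) operator \<Rightarrow> ('n, 'k) operator set" where
  "centralizer L D = {E \<in> L. bracket D E = 0}"

definition abelian :: "('n, 'k::field) operator set \<Rightarrow> bool" where
  "abelian A \<longleftrightarrow> (\<forall>E\<in>A. \<forall>F\<in>A. bracket E F = 0)"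

text \<open>
  The constants of the locale \<^locale>\<open>module\<close> used above are meaningful only when the
  respective scalar multiplication satisfies the module axioms, which is checked here.
\<close>

lemma vector_space_scale_poly: "vector_space scale_poly"
  by standard
    (simp_all add: scale_poly_def const_def algebra_simps mult_single single_add
      flip: mult.assoc)

lemma module_scale_op: "module scale_op"
  by standard (auto simp: scale_op_def algebra_simps)

lemma vector_space_scalar_op: "vector_space scalar_op"
proof -
  interpret vector_space scale_poly by (rule vector_space_scale_poly)
  show ?thesis
    by standard
      (auto simp: scalar_op_def scale_right_distrib scale_left_distrib)
qed

lemma derivation_iff:
  "derivation D \<longleftrightarrow>
     (\<forall>p q. D (p + q) = D p + D q) \<and> (\<forall>c p. D (scale_poly c p) = scale_poly c (D p)) \<and>
     (\<forall>p q. D (p * q) = D p * q + p * D q)"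
  using vector_space_scale_poly
  by (auto simp: derivation_def linear_iff_module_hom module_hom_iff module_iff_vector_space)

lemma bracket_eq_commutator: "bracket D E = (D \<circ> E) - (E \<circ> D)"
  by (auto simp: bracket_def)

lemma lie_subalgebra_W_W: "lie_subalgebra_W (W :: ('n, 'k::field) operator set)"
proof -
  interpret vector_space scale_poly by (rule vector_space_scale_poly)
  interpret op: vector_space scalar_op by (rule vector_space_scalar_op)
  have mult: "p * scale_poly c q = scale_poly c (p * q)" "scale_poly c p * q = scale_poly c (p * q)"
    for p q :: "('n, 'k) mpoly" and c
    by (simp_all add: scale_poly_def mult_ac)
  have "op.subspace (W :: ('n, 'k) operator set)"
    unfolding op.subspace_def
    by (auto simp: W_def derivation_iff scalar_op_def algebra_simps scale_right_distrib mult)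
  moreover have "bracket D E \<in> W" if "D \<in> W" "E \<in> W" for D E :: "('n, 'k) operator"
    using that unfolding W_def derivation_iff bracket_def
    by (auto simp: scale_right_diff_distrib algebra_simps)
  ultimately show ?thesis
    by (auto simp: lie_subalgebra_W_def)
qed

lemma submodule_W_W: "submodule_W (W :: ('n, 'k::field) operator set)"
proof -
  interpret op: module scale_op by (rule module_scale_op)
  have "op.subspace (W :: ('n, 'k) operator set)"
    unfolding op.subspace_def
    by (auto simp: W_def derivation_iff scale_op_def scale_poly_def algebra_simps)
  then show ?thesis
    by (simp add: submodule_W_def)
qed

end

theory Submission
  imports Defs
begin

text \<open>
  Let \<open>E\<close> and \<open>F\<close> be elements of \<open>L\<close> that commute with \<open>D\<close>.  In rank one, \<open>E\<close> is a
  rational multiple of \<open>D\<close> (\<open>rank_one_proportional\<close>): clearing denominators, \<open>a E = b D\<close>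
  with \<open>a \<noteq> 0\<close>.  Since \<open>E\<close> commutes with \<open>D\<close>, the quotient \<open>b / a\<close> is a constant of \<open>D\<close>,
  that is, \<open>b D(a) = a D(b)\<close> (\<open>commuting_multiple_ratio_constant\<close>).  Now \<open>F\<close> is a
  rational multiple of \<open>D\<close> as well, so it also annihilates \<open>b / a\<close>.  Hence
  \<open>[F, E] = [F, (b / a) D] = (b / a) [F, D] = 0\<close> (\<open>bracket_commuting_multiple\<close>).

  The computation is carried out without the field of fractions, by multiplying with
  denominators and cancelling them afterwards.  This requires that the polynomial ring
  has no zero divisors, which is proved by comparing leading monomials
  (\<open>poly_mapping_no_zero_divisors\<close>).
\<close>

text \<open>
  The leading terms of two nonzero elements cannot cancel in their product.  Which
  term leads is decided by pulling back an order along an additive injection \<open>\<phi>\<close>, because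
  exponent vectors over an arbitrary finite set of variables have no canonical monomial order.
\<close>

lemma poly_mapping_no_zero_divisors:
  fixes \<phi> :: "'a::comm_monoid_add \<Rightarrow> 'b::{linorder, ordered_cancel_comm_monoid_add}"
    and p q :: "'a \<Rightarrow>\<^sub>0 'k::semiring_no_zero_divisors"
  assumes "inj \<phi>" and additive: "\<And>x y. \<phi> (x + y) = \<phi> x + \<phi> y"
    and "p \<noteq> 0" "q \<noteq> 0"
  shows "p * q \<noteq> 0"
proof -
  have leading: "\<exists>s\<in>Poly_Mapping.keys r. \<forall>x\<in>Poly_Mapping.keys r. x \<noteq> s \<longrightarrow> \<phi> x < \<phi> s"
    if "r \<noteq> 0" for r :: "'a \<Rightarrow>\<^sub>0 'k"
  proof -
    have "Max (\<phi> ` Poly_Mapping.keys r) \<in> \<phi> ` Poly_Mapping.keys r"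
      using that by (intro Max_in) auto
    then obtain s where s: "s \<in> Poly_Mapping.keys r" "\<phi> s = Max (\<phi> ` Poly_Mapping.keys r)"
      by auto
    have "\<phi> x < \<phi> s" if "x \<in> Poly_Mapping.keys r" "x \<noteq> s" for x
      using that s injD[OF \<open>inj \<phi>\<close>, of x s] by (auto simp: less_le)
    with s(1) show ?thesis by blast
  qed
  obtain s where s: "s \<in> Poly_Mapping.keys p"
      "\<And>x. x \<in> Poly_Mapping.keys p \<Longrightarrow> x \<noteq> s \<Longrightarrow> \<phi> x < \<phi> s"
    using leading[OF \<open>p \<noteq> 0\<close>] by blast
  obtain t where t: "t \<in> Poly_Mapping.keys q"
      "\<And>x. x \<in> Poly_Mapping.keys q \<Longrightarrow> x \<noteq> t \<Longrightarrow> \<phi> x < \<phi> t"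
    using leading[OF \<open>q \<noteq> 0\<close>] by blast
  have only: "x = s \<and> y = t"
    if "x \<in> Poly_Mapping.keys p" "y \<in> Poly_Mapping.keys q" "x + y = s + t" for x y
  proof (rule ccontr)
    assume "\<not> ?thesis"
    then have "\<phi> x + \<phi> y < \<phi> s + \<phi> t"
      using s(2)[OF that(1)] t(2)[OF that(2)]
      by (cases "x = s"; cases "y = t")
         (auto intro: add_strict_mono add_strict_left_mono add_strict_right_mono)
    then show False
      using additive[of x y] additive[of s t] that(3) by simp
  qed
  let ?a = "Poly_Mapping.lookup p" and ?b = "Poly_Mapping.lookup q"
  let ?A = "Poly_Mapping.keys p" and ?B = "Poly_Mapping.keys q"
  have monomials: "r = (\<Sum>x\<in>Poly_Mapping.keys r. Poly_Mapping.single x (Poly_Mapping.lookup r x))"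
    for r :: "'a \<Rightarrow>\<^sub>0 'k"
    by (rule poly_mapping_eqI)
       (simp add: lookup_sum lookup_single when_def sum.delta' not_in_keys_iff_lookup_eq_zero)
  have "p * q = (\<Sum>x\<in>?A. \<Sum>y\<in>?B. Poly_Mapping.single (x + y) (?a x * ?b y))"
    by (subst monomials[of p], subst monomials[of q]) (simp add: sum_product mult_single)
  then have "Poly_Mapping.lookup (p * q) (s + t) =
      (\<Sum>x\<in>?A. \<Sum>y\<in>?B. (?a x * ?b y when x + y = s + t))"
    by (simp add: lookup_sum lookup_single)
  also have "\<dots> = (\<Sum>x\<in>?A. \<Sum>y\<in>?B. if x = s then if y = t then ?a s * ?b t else 0 else 0)"
    using only by (intro sum.cong refl) (auto simp: when_def)
  also have "\<dots> = (\<Sum>x\<in>?A. if x = s then ?a s * ?b t else 0)"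
    using t(1) by (intro sum.cong refl) (auto simp: sum.delta)
  also have "\<dots> = ?a s * ?b t"
    using s(1) by (simp add: sum.delta)
  also have "\<dots> \<noteq> 0"
    using s(1) t(1) by (simp add: in_keys_iff)
  finally show ?thesis by auto
qed

text \<open>
  Numbering the variables turns exponent vectors into finitely supported functions on the
  natural numbers, which are ordered lexicographically.
\<close>

lemma mpoly_mult_eq_0_iff:
  fixes p q :: "('n::finite, 'k::field) mpoly"
  shows "p * q = 0 \<longleftrightarrow> p = 0 \<or> q = 0"
proof -
  obtain e :: "'n \<Rightarrow> nat" where "inj e"
    using finite_imp_inj_to_nat_seg[OF finite_UNIV] by blast
  define \<phi> :: "('n \<Rightarrow>\<^sub>0 nat) \<Rightarrow> (nat \<Rightarrow>\<^sub>0 nat)"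
    where "\<phi> m = (\<Sum>i\<in>UNIV. Poly_Mapping.single (e i) (Poly_Mapping.lookup m i))" for m
  have "Poly_Mapping.lookup (\<phi> m) (e j) = Poly_Mapping.lookup m j" for m j
    by (simp add: \<phi>_def lookup_sum lookup_single when_def inj_eq[OF \<open>inj e\<close>])
  then have "inj \<phi>"
    by (metis injI poly_mapping_eqI)
  moreover have "\<phi> (x + y) = \<phi> x + \<phi> y" for x y
    by (simp add: \<phi>_def lookup_add single_add sum.distrib)
  ultimately show ?thesis
    using poly_mapping_no_zero_divisors[of \<phi> p q] by auto
qed

lemma mpoly_mult_left_cancel:
  fixes a p q :: "('n::finite, 'k::field) mpoly"
  assumes "a \<noteq> 0" "a * p = a * q"
  shows "p = q"
  using assms mpoly_mult_eq_0_iff[of a "p - q"] by (simp add: right_diff_distrib)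

lemma W_mult: "D \<in> W \<Longrightarrow> D (p * q) = D p * q + p * D q"
  by (simp add: W_def derivation_def)

lemma rank_one_proportional:
  fixes L :: "('n::finite, 'k::field) operator set"
  assumes "rank L = 1" and "D \<in> L" "D \<noteq> 0" and "E \<in> L"
  obtains a b where "a \<noteq> 0" "\<And>p. a * E p = b * D p"
proof (cases "E = D")
  case True
  then show ?thesis
    using that[of 1 1] by simp
next
  case False
  interpret op: module "scale_op :: _ \<Rightarrow> ('n, 'k) operator \<Rightarrow> _"
    by (rule module_scale_op)
  have "op.dependent {D, E}"
  proof (rule ccontr)
    assume "\<not> op.dependent {D, E}"
    then have "enat (card {D, E}) \<le> rank L"
      unfolding rank_def using assms by (intro SUP_upper) auto
    then show False
      using False assms(1) by (simp add: one_enat_def)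
  qed
  then obtain u where u: "u D \<noteq> 0 \<or> u E \<noteq> 0" "(\<Sum>v\<in>{D, E}. scale_op (u v) v) = 0"
    by (auto simp: op.dependent_finite)
  have relation: "u D * D p + u E * E p = 0" for p
    using fun_cong[OF u(2), of p] False by (simp add: scale_op_def)
  have "u E \<noteq> 0"
  proof
    assume "u E = 0"
    with u(1) have "D p = 0" for p
      using relation[of p] by (simp add: mpoly_mult_eq_0_iff)
    with \<open>D \<noteq> 0\<close> show False by (auto simp: fun_eq_iff)
  qed
  moreover have "u E * E p = - u D * D p" for p
    using relation[of p] by (simp add: eq_neg_iff_add_eq_0 add.commute)
  ultimately show ?thesis using that by blast
qed

text \<open>
  Bracketing \<open>D\<close> with both sides of \<open>a E = b D\<close> gives \<open>D(a) E = D(b) D\<close>; multiplying by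
  \<open>a\<close> and using the proportionality once more turns this into \<open>b D(a) D = a D(b) D\<close>.
  For \<open>a \<noteq> 0\<close> the conclusion is the denominator-free form of \<open>D(b / a) = 0\<close>.
\<close>

lemma commuting_multiple_ratio_constant:
  fixes D E :: "('n::finite, 'k::field) operator"
  assumes D: "D \<in> W" "D \<noteq> 0"
    and multiple: "\<And>p. a * E p = b * D p"
    and commute: "\<And>p. D (E p) = E (D p)"
  shows "b * D a = a * D b"
proof -
  obtain p where "D p \<noteq> 0"
    using D(2) by (auto simp: fun_eq_iff)
  have "D (a * E p) = D (b * D p)"
    by (simp add: multiple)
  then have "D a * E p + a * D (E p) = D b * D p + b * D (D p)"
    by (simp only: W_mult[OF D(1)])
  then have "D a * E p = D b * D p"
    by (simp add: commute multiple)
  then have "D a * (a * E p) = a * (D b * D p)"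
    by (simp add: mult_ac)
  then have "D p * (b * D a) = D p * (a * D b)"
    by (simp add: multiple mult_ac)
  then show ?thesis
    by (rule mpoly_mult_left_cancel[OF \<open>D p \<noteq> 0\<close>])
qed

text \<open>
  For \<open>a \<noteq> 0\<close> and \<open>f = b / a\<close>, so that \<open>E = f D\<close>, this is the identity
  \<open>[F, f D] = F(f) D + f [F, D]\<close>, whose second summand is zero; the factor
  \<open>a\<^sup>2\<close> is the denominator of \<open>F(f)\<close>.
\<close>

lemma bracket_commuting_multiple:
  fixes D E F :: "('n, 'k::field) operator"
  assumes F: "F \<in> W"
    and multiple: "\<And>p. a * E p = b * D p"
    and commute: "\<And>p. D (F p) = F (D p)"
  shows "a * (a * bracket E F p) = (b * F a - a * F b) * D p"
proof -
  have leibniz: "F a * E p + a * F (E p) = F b * D p + b * F (D p)"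
    using W_mult[OF F, of a "E p"] W_mult[OF F, of b "D p"] by (simp add: multiple)
  have "b * F (D p) - a * F (E p) = F a * E p - F b * D p"
    by (simp add: diff_eq_eq diff_add_eq leibniz)
  then have "a * bracket E F p = F a * E p - F b * D p"
    by (simp add: bracket_def right_diff_distrib multiple commute)
  then have "a * (a * bracket E F p) = F a * (a * E p) - a * F b * D p"
    by (simp add: right_diff_distrib mult_ac)
  also have "\<dots> = (b * F a - a * F b) * D p"
    by (simp add: multiple algebra_simps)
  finally show ?thesis .
qed

theorem proposition1:
  fixes L :: "('n::finite, 'k::{alg_closed_field, field_char_0}) operator set"
  assumes "lie_subalgebra_W L"
    and "submodule_W L"
    and "rank L = 1"
    and "D \<in> L"
    and "D \<noteq> 0"
  shows "abelian (centralizer L D)"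
  unfolding abelian_def
proof (intro ballI)
  fix E F
  assume "E \<in> centralizer L D" "F \<in> centralizer L D"
  then have L: "E \<in> L" "F \<in> L"
    and E: "D (E p) = E (D p)" and F: "D (F p) = F (D p)" for p
    by (auto simp: centralizer_def bracket_def fun_eq_iff)
  have W: "D \<in> W" "F \<in> W"
    using assms L by (auto simp: submodule_W_def)
  obtain a b where "a \<noteq> 0" and ab: "\<And>p. a * E p = b * D p"
    using rank_one_proportional[OF assms(3-5) L(1)] by blast
  obtain c d where "c \<noteq> 0" and cd: "\<And>p. c * F p = d * D p"
    using rank_one_proportional[OF assms(3-5) L(2)] by blast
  have ratio: "b * D a = a * D b"
    by (rule commuting_multiple_ratio_constant[OF W(1) assms(5) ab E])
  \<comment> \<open>Since \<open>c F = d D\<close>, the quotient \<open>b / a\<close> is a constant of \<open>F\<close> too.\<close>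
  have "c * (b * F a) = c * (a * F b)"
  proof -
    have "c * (b * F a) = b * (c * F a)" by (simp add: mult_ac)
    also have "\<dots> = d * (b * D a)" by (simp add: cd mult_ac)
    also have "\<dots> = a * (d * D b)" by (simp add: ratio mult_ac)
    also have "\<dots> = c * (a * F b)" by (simp add: mult_ac flip: cd)
    finally show ?thesis .
  qed
  then have "b * F a = a * F b"
    by (rule mpoly_mult_left_cancel[OF \<open>c \<noteq> 0\<close>])
  then have "a * (a * bracket E F p) = 0" for p
    using bracket_commuting_multiple[of F a E b D p, OF W(2) ab F] by simp
  then show "bracket E F = 0"
    using \<open>a \<noteq> 0\<close> by (simp add: mpoly_mult_eq_0_iff fun_eq_iff)
qed

end
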